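(* For all integers $n,m\geq 2$, $R(P_n,K_{1,m})=t(n,m)$.
   Context: All graphs are finite and simple. $P_n$ denotes the path on $n$ vertices and $K_{1,m}$ the star on $m+1$ vertices. For graphs $G_1,G_2$, the Ramsey number $R(G_1,G_2)$ is the least integer $r$ such that for every graph $G$ on $r$ vertices, either $G$ contains a subgraph isomorphic to $G_1$ or the complement $\overline{G}$ contains a subgraph isomorphic to $G_2$. For integers $n,m\geq 2$, let $\alpha=\frac{m-1}{n-1}$, $\beta=\lceil\alpha\rceil$ and $\gamma=\frac{\beta^2}{\beta+1}$, and define $$t(n,m)=\begin{cases}(n-1)\beta+1, & \alpha\leq\gamma;\\ \lfloor (m-1)/\beta\rfloor+m, & \alpha>\gamma.\end{cases}$$ *)

theory Defs
  imports Complex_Main "HOL-Library.Ramsey"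
begin

text \<open>
  A graph is a pair of a vertex set and a set of edges, an edge being a two-element
  set of vertices. The set of all two-element subsets of \<open>V\<close> is \<open>nsets V 2\<close>, also
  written \<open>[V]\<^bsup>2\<^esup>\<close>.
\<close>

type_synonym 'a graph = "'a set \<times> 'a set set"

abbreviation verts :: "'a graph \<Rightarrow> 'a set" where "verts \<equiv> fst"

abbreviation edges :: "'a graph \<Rightarrow> 'a set set" where "edges \<equiv> snd"

definition simple_graph :: "'a graph \<Rightarrow> bool" where
  "simple_graph G \<longleftrightarrow> finite (verts G) \<and> edges G \<subseteq> nsets (verts G) 2"

definition complement :: "'a graph \<Rightarrow> 'a graph" where
  "complement G = (verts G, nsets (verts G) 2 - edges G)"

definition subgraph :: "'a graph \<Rightarrow> 'a graph \<Rightarrow> bool" where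
  "subgraph H G \<longleftrightarrow> simple_graph H \<and> verts H \<subseteq> verts G \<and> edges H \<subseteq> edges G"

definition isomorphic :: "'a graph \<Rightarrow> 'b graph \<Rightarrow> bool" where
  "isomorphic G H \<longleftrightarrow>
     (\<exists>f. bij_betw f (verts G) (verts H) \<and> edges H = (\<lambda>e. f ` e) ` edges G)"

definition contains_copy :: "'a graph \<Rightarrow> 'b graph \<Rightarrow> bool" where
  "contains_copy G F \<longleftrightarrow> (\<exists>H. subgraph H G \<and> isomorphic H F)"

text \<open>
  Every finite graph is isomorphic to one with natural numbers as vertices, so it
  suffices to let \<open>G\<close> range over graphs of this type.
\<close>

definition ramsey_number :: "'a graph \<Rightarrow> 'b graph \<Rightarrow> nat" where
  "ramsey_number G1 G2 =
     (LEAST r. \<forall>G :: nat graph. simple_graph G \<and> card (verts G) = r \<longrightarrow>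
        contains_copy G G1 \<or> contains_copy (complement G) G2)"

definition path_graph :: "nat \<Rightarrow> nat graph" where
  "path_graph n = ({..<n}, {{i, Suc i} | i. Suc i < n})"

definition star_graph :: "nat \<Rightarrow> nat graph" where
  "star_graph m = ({..m}, {{0, i} | i. i \<in> {1..m}})"

lemma simple_graph_complement: "simple_graph G \<Longrightarrow> simple_graph (complement G)"
  by (auto simp: simple_graph_def complement_def)

lemma simple_graph_path_graph: "simple_graph (path_graph n)"
  by (auto simp: simple_graph_def path_graph_def nsets_def)

lemma simple_graph_star_graph: "simple_graph (star_graph m)"
  by (auto simp: simple_graph_def star_graph_def nsets_def)

definition alpha :: "nat \<Rightarrow> nat \<Rightarrow> real" where
  "alpha n m = (real m - 1) / (real n - 1)"

definition beta :: "nat \<Rightarrow> nat \<Rightarrow> int" where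
  "beta n m = \<lceil>alpha n m\<rceil>"

definition gamma :: "nat \<Rightarrow> nat \<Rightarrow> real" where
  "gamma n m = (real_of_int (beta n m))\<^sup>2 / (real_of_int (beta n m) + 1)"

definition t :: "nat \<Rightarrow> nat \<Rightarrow> int" where
  "t n m =
     (if alpha n m \<le> gamma n m then (int n - 1) * beta n m + 1
      else \<lfloor>(real m - 1) / real_of_int (beta n m)\<rfloor> + int m)"

end

theory Submission
  imports Defs
begin

text \<open>
  Write \<open>N = n - 1\<close>, \<open>M = m - 1\<close> and \<open>b = \<lceil>M / N\<rceil>\<close>. A graph on \<open>r\<close> vertices whose complement
  contains no \<open>K\<^bsub>1,m\<^esub>\<close> is a graph of minimum degree at least \<open>d = r - m\<close>. For \<open>r = t(n,m)\<close> one
  has \<open>N \<le> 2 d\<close>, so by Dirac's rotation argument every component with more than \<open>N\<close> vertices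
  contains \<open>P\<^sub>n\<close>. If all components have at most \<open>N\<close> vertices, then \<open>r > N b\<close> forces at least
  \<open>b + 1\<close> of them, each with more than \<open>d\<close> vertices, contradicting \<open>r < (b + 1) (d + 1)\<close>.
  On \<open>t(n,m) - 1\<close> vertices, a disjoint union of cliques of nearly equal size avoids both
  graphs: \<open>b\<close> cliques if \<open>\<alpha> \<le> \<gamma>\<close>, and \<open>b + 1\<close> cliques otherwise.
\<close>

section \<open>Copies as embeddings: paths as vertex lists, stars as degrees\<close>

lemma contains_copyI:
  assumes F: "simple_graph F" and inj: "inj_on g (verts F)"
    and g_verts: "g ` verts F \<subseteq> verts G"
    and g_edges: "\<And>e. e \<in> edges F \<Longrightarrow> g ` e \<in> edges G"
  shows "contains_copy G F"
proof -
  define H where "H = (g ` verts F, (\<lambda>e. g ` e) ` edges F)"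
  have sub: "e \<subseteq> verts F \<and> finite e \<and> card e = 2" if "e \<in> edges F" for e
    using F that unfolding simple_graph_def nsets_def by blast
  have "simple_graph H"
    unfolding simple_graph_def
  proof
    show "finite (verts H)"
      using F by (simp add: H_def simple_graph_def)
    show "edges H \<subseteq> nsets (verts H) 2"
    proof
      fix e assume "e \<in> edges H"
      then obtain d where d: "d \<in> edges F" "e = g ` d"
        by (auto simp: H_def)
      moreover have "card (g ` d) = card d"
        using sub[OF d(1)] inj by (meson card_image inj_on_subset)
      ultimately show "e \<in> nsets (verts H) 2"
        using sub[OF d(1)] by (auto simp: nsets_def H_def)
    qed
  qed
  then have "subgraph H G"
    using g_verts g_edges by (auto simp: subgraph_def H_def)
  moreover have "isomorphic H F"
    unfolding isomorphic_def
  proof (intro exI conjI)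
    \<comment> \<open>\<open>isomorphic\<close> asks for a map from the copy onto \<open>F\<close>,
      so the witness is the inverse of the embedding.\<close>
    show "bij_betw (inv_into (verts F) g) (verts H) (verts F)"
      using inj by (simp add: H_def bij_betw_inv_into inj_on_imp_bij_betw)
    have "inv_into (verts F) g ` g ` e = e" if "e \<in> edges F" for e
      using sub[OF that] inj by (simp add: inv_into_image_cancel)
    then show "edges F = (\<lambda>e. inv_into (verts F) g ` e) ` edges H"
      by (simp add: H_def image_image)
  qed
  ultimately show ?thesis
    unfolding contains_copy_def by blast
qed

lemma contains_copyE:
  assumes "contains_copy G F"
  obtains g where "inj_on g (verts F)" "g ` verts F \<subseteq> verts G"
    "\<And>e. e \<in> edges F \<Longrightarrow> g ` e \<in> edges G"
proof -
  obtain H f where H: "subgraph H G" and f: "bij_betw f (verts H) (verts F)"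
    and e: "edges F = (\<lambda>e. f ` e) ` edges H"
    using assms unfolding contains_copy_def isomorphic_def by blast
  let ?g = "inv_into (verts H) f"
  have "bij_betw ?g (verts F) (verts H)"
    using f by (rule bij_betw_inv_into)
  moreover have "?g ` f ` d = d" if "d \<in> edges H" for d
  proof (rule inv_into_image_cancel)
    show "inj_on f (verts H)"
      using f by (simp add: bij_betw_def)
    show "d \<subseteq> verts H"
      using H that unfolding subgraph_def simple_graph_def nsets_def by blast
  qed
  then have "?g ` d \<in> edges G" if "d \<in> edges F" for d
    using that e H by (auto simp: subgraph_def)
  ultimately show ?thesis
    using H that[of ?g] by (auto simp: subgraph_def bij_betw_def)
qed

text \<open>The rotation argument cuts, reverses and concatenates paths; on vertex lists these are
  ordinary list operations.\<close>

lemma contains_path_graph_iff: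
  "contains_copy G (path_graph n) \<longleftrightarrow>
    (\<exists>p. distinct p \<and> length p = n \<and> set p \<subseteq> verts G \<and> successively (\<lambda>x y. {x, y} \<in> edges G) p)"
proof
  assume "contains_copy G (path_graph n)"
  then obtain g where g: "inj_on g {..<n}" "g ` {..<n} \<subseteq> verts G"
      "\<And>e. e \<in> edges (path_graph n) \<Longrightarrow> g ` e \<in> edges G"
    by (auto simp: path_graph_def elim: contains_copyE)
  have "{g i, g (Suc i)} \<in> edges G" if "Suc i < n" for i
    using g(3)[of "{i, Suc i}"] that by (auto simp: path_graph_def)
  then show "\<exists>p. distinct p \<and> length p = n \<and> set p \<subseteq> verts G \<and> successively (\<lambda>x y. {x, y} \<in> edges G) p"
    using g by (intro exI[of _ "map g [0..<n]"])
      (auto simp: distinct_map successively_conv_nth atLeast0LessThan)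
next
  assume "\<exists>p. distinct p \<and> length p = n \<and> set p \<subseteq> verts G \<and> successively (\<lambda>x y. {x, y} \<in> edges G) p"
  then obtain p where "distinct p" "length p = n" "set p \<subseteq> verts G"
    "successively (\<lambda>x y. {x, y} \<in> edges G) p"
    by blast
  then show "contains_copy G (path_graph n)"
    by (intro contains_copyI[where g = "(!) p"] simple_graph_path_graph)
      (auto simp: path_graph_def inj_on_def nth_eq_iff_index_eq successively_conv_nth)
qed

text \<open>Any \<open>m\<close> neighbours of \<open>v\<close> serve as leaves, since simplicity
  keeps \<open>v\<close> out of its own neighbourhood. Excluding a star from the complement thus
  becomes a bound on degrees.\<close>

lemma contains_star_graph_iff:
  assumes "simple_graph G"
  shows "contains_copy G (star_graph m) \<longleftrightarrow> (\<exists>v\<in>verts G. m \<le> card {w. {v, w} \<in> edges G})"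
proof
  have fin: "finite {w. {v, w} \<in> edges G}" for v
    using assms by (auto simp: simple_graph_def nsets_def intro: rev_finite_subset[of "verts G"])
  {
    assume "contains_copy G (star_graph m)"
    then obtain g where g: "inj_on g {..m}" "g ` {..m} \<subseteq> verts G"
        "\<And>e. e \<in> edges (star_graph m) \<Longrightarrow> g ` e \<in> edges G"
      by (auto simp: star_graph_def elim: contains_copyE)
    have "{g 0, g i} \<in> edges G" if "i \<in> {1..m}" for i
      using g(3)[of "{0, i}"] that by (auto simp: star_graph_def)
    then have "g ` {1..m} \<subseteq> {w. {g 0, w} \<in> edges G}"
      by auto
    moreover have "card (g ` {1..m}) = m"
      using g(1) by (subst card_image) (auto intro: inj_on_subset)
    ultimately have "m \<le> card {w. {g 0, w} \<in> edges G}"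
      using card_mono[OF fin] by metis
    then show "\<exists>v\<in>verts G. m \<le> card {w. {v, w} \<in> edges G}"
      using g(2) by auto
  next
    assume "\<exists>v\<in>verts G. m \<le> card {w. {v, w} \<in> edges G}"
    then obtain v where v: "v \<in> verts G" "card {1..m} \<le> card {w. {v, w} \<in> edges G}"
      by auto
    then obtain h where h: "h ` {1..m} \<subseteq> {w. {v, w} \<in> edges G}" "inj_on h {1..m}"
      using card_le_inj[OF _ fin] by blast
    have nbr: "h i \<in> verts G \<and> h i \<noteq> v \<and> {v, h i} \<in> edges G" if "i \<in> {1..m}" for i
    proof -
      have "{v, h i} \<in> edges G"
        using h(1) that by blast
      moreover from this have "{v, h i} \<in> nsets (verts G) 2"
        using assms unfolding simple_graph_def by blast
      ultimately show ?thesis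
        by auto
    qed
    define g where "g i = (if i = 0 then v else h i)" for i
    have g: "g 0 = v" "\<And>i. i \<in> {1..m} \<Longrightarrow> g i = h i"
      by (simp_all add: g_def)
    have verts: "verts (star_graph m) = insert 0 {1..m}"
      by (auto simp: star_graph_def)
    show "contains_copy G (star_graph m)"
    proof (rule contains_copyI[OF simple_graph_star_graph])
      have "inj_on g {1..m}"
        using h(2) g(2) inj_on_cong[of "{1..m}" g h] by blast
      moreover have "g 0 \<notin> g ` {1..m}"
        using g nbr by (metis imageE)
      ultimately show "inj_on g (verts (star_graph m))"
        unfolding verts by simp
      show "g ` verts (star_graph m) \<subseteq> verts G"
        unfolding verts using g nbr v(1) by auto
      show "g ` e \<in> edges G" if e: "e \<in> edges (star_graph m)" for e
      proof -
        obtain i where "e = {0, i}" "i \<in> {1..m}"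
          using e by (auto simp: star_graph_def)
        then show ?thesis
          using g nbr by simp
      qed
    qed
  }
qed

section \<open>Long paths in graphs of large minimum degree\<close>

locale finite_adjacency =
  fixes V :: "'a set" and adj :: "'a \<Rightarrow> 'a \<Rightarrow> bool"
  assumes finite_V: "finite V"
    and adj_in: "adj x y \<Longrightarrow> y \<in> V"
    and adj_sym: "adj x y \<Longrightarrow> adj y x"
    and adj_irrefl: "\<not> adj x x"
begin

lemma successively_adj_rev: "successively adj (rev xs) \<longleftrightarrow> successively adj xs"
  using adj_sym by (auto elim: successively_mono)

text \<open>For use on a longest path \<open>xs @ ys\<close>: the link from \<open>last xs\<close>
  to \<open>hd ys\<close> is given up, and the two crossing chords in \<open>ends\<close> take its
  place. The outside neighbour \<open>w\<close> then yields a longer path.\<close>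

lemma path_extension:
  assumes dist: "distinct (xs @ ys)" and ne: "xs \<noteq> []" "ys \<noteq> []"
    and paths: "successively adj xs" "successively adj ys"
    and ends: "adj (hd xs) (hd ys)" "adj (last xs) (last ys)"
    and u: "u \<in> set (xs @ ys)" "adj w u" and w: "w \<notin> set (xs @ ys)"
  shows "\<exists>q. distinct q \<and> successively adj q \<and> set q = insert w (set (xs @ ys))
    \<and> length q = Suc (length (xs @ ys))"
proof -
  \<comment> \<open>Traversing \<open>xs\<close> forwards and \<open>ys\<close> backwards gives a cycle; open it at \<open>u\<close>.\<close>
  let ?c = "xs @ rev ys"
  have c: "successively adj ?c" "adj (last ?c) (hd ?c)"
    using ne paths ends adj_sym
    by (auto simp: successively_append_iff successively_adj_rev hd_rev last_rev simp del: successively_rev)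
  obtain a b where ab: "?c = a @ u # b"
    using u(1) split_list[of u ?c] by auto
  have mem: "set (a @ u # b) = set (xs @ ys)" "distinct (a @ u # b)"
      "length (a @ u # b) = length (xs @ ys)"
    using dist unfolding ab[symmetric] by auto
  have "successively adj (w # (u # b) @ a)"
  \<comment> \<open>If \<open>a\<close> is empty, the cycle is already opened at \<open>u\<close>.
    Otherwise the closing edge of \<open>?c\<close> leads from the end of \<open>u # b\<close> back
    to the start of \<open>a\<close>.\<close>
  proof (cases "a = []")
    case True
    then show ?thesis
      using c u(2) unfolding ab by simp
  next
    case False
    have "last ?c = last (u # b)" "hd ?c = hd a"
      using False unfolding ab by simp_all
    then have "successively adj ((u # b) @ a)"
      using c unfolding ab successively_append_iff by simp
    then show ?thesis
      using u(2) adj_sym by simp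
  qed
  then show ?thesis
    using mem w by (intro exI[of _ "w # (u # b) @ a"]) auto
qed

text \<open>A longest path in \<open>C\<close> with fewer than \<open>k\<close> vertices contains
  all neighbours of both its ends. The degree bound forces crossing chords, which turn it into a
  cycle, and connectedness supplies an edge leaving that cycle, so a longer path exists.\<close>

lemma path_in_connected_set:
  assumes "C \<subseteq> V" "C \<noteq> {}"
    and conn: "\<And>x y. x \<in> C \<Longrightarrow> y \<in> C \<Longrightarrow> adj\<^sup>*\<^sup>* x y"
    and closed: "\<And>x y. x \<in> C \<Longrightarrow> adj x y \<Longrightarrow> y \<in> C"
    and deg: "\<And>x. x \<in> C \<Longrightarrow> d \<le> card {y. adj x y}"
    and k: "k \<le> 2 * d + 1" "k \<le> card C"
  shows "\<exists>p. distinct p \<and> length p = k \<and> set p \<subseteq> C \<and> successively adj p"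
proof -
  define P where "P p \<longleftrightarrow> p \<noteq> [] \<and> distinct p \<and> set p \<subseteq> C \<and> successively adj p" for p
  have fin: "finite C"
    using assms(1) finite_V finite_subset by blast
  obtain c where "c \<in> C"
    using assms(2) by blast
  then have "P [c]"
    by (simp add: P_def)
  moreover have "\<forall>q. P q \<longrightarrow> length q < Suc (card C)"
    using fin by (metis P_def card_mono distinct_card le_imp_less_Suc)
  ultimately obtain p where p: "P p" and max: "\<And>q. P q \<Longrightarrow> length q \<le> length p"
    using ex_has_greatest_nat[of P "[c]" length] by blast
  have ne: "p \<noteq> []" and dist: "distinct p" and pC: "set p \<subseteq> C" and path: "successively adj p"
    using p by (simp_all add: P_def)
  show ?thesis
  proof (cases "k \<le> length p")
    case True
    have "successively adj (take k p @ drop k p)"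
      using path by simp
    then have "successively adj (take k p)"
      unfolding successively_append_iff by blast
    then show ?thesis
      using True dist pC set_take_subset[of k p] by (intro exI[of _ "take k p"]) auto
  next
    case False
    let ?l = "length p"
    have hd_nbrs: "x \<in> set p" if "adj (hd p) x" for x
    proof (rule ccontr)
      assume "x \<notin> set p"
      moreover have "x \<in> C"
        using that closed pC hd_in_set[OF ne] by blast
      ultimately have "P (x # p)"
        using p that adj_sym by (simp add: P_def successively_Cons)
      then show False
        using max by fastforce
    qed
    have last_nbrs: "x \<in> set p" if "adj (last p) x" for x
    proof (rule ccontr)
      assume "x \<notin> set p"
      moreover have "x \<in> C"
        using that closed pC last_in_set[OF ne] by blast
      ultimately have "P (p @ [x])"
        using p that by (simp add: P_def successively_append_iff)
      then show False
        using max by fastforce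
    qed
    \<comment> \<open>Both sets index links of \<open>p\<close> by their left vertex:
      \<open>A\<close> those whose right vertex is adjacent to the first vertex of \<open>p\<close>,
      \<open>B\<close> those whose left vertex is adjacent to the last. A common index gives the
      crossing chords. Irreflexivity ensures that no neighbour is lost, so each set has at least
      \<open>d\<close> elements.\<close>
    define A where "A = {i. i < ?l - 1 \<and> adj (hd p) (p ! Suc i)}"
    define B where "B = {i. i < ?l - 1 \<and> adj (last p) (p ! i)}"
    have "{y. adj (hd p) y} \<subseteq> (\<lambda>i. p ! Suc i) ` A"
    proof
      fix y assume y: "y \<in> {y. adj (hd p) y}"
      then obtain i where i: "i < ?l" "p ! i = y"
        using hd_nbrs in_set_conv_nth[of y p] by auto
      moreover have "i \<noteq> 0"
        using i y ne adj_irrefl by (metis hd_conv_nth mem_Collect_eq)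
      ultimately show "y \<in> (\<lambda>i. p ! Suc i) ` A"
        using y by (intro image_eqI[of _ _ "i - 1"]) (auto simp: A_def)
    qed
    then have "card {y. adj (hd p) y} \<le> card A"
      by (intro surj_card_le) (simp_all add: A_def)
    then have "d \<le> card A"
      using deg[of "hd p"] pC hd_in_set[OF ne] by (meson order_trans subsetD)
    have "{y. adj (last p) y} \<subseteq> (\<lambda>i. p ! i) ` B"
    proof
      fix y assume y: "y \<in> {y. adj (last p) y}"
      then obtain i where i: "i < ?l" "p ! i = y"
        using last_nbrs in_set_conv_nth[of y p] by auto
      moreover have "i \<noteq> ?l - 1"
        using i y ne adj_irrefl by (auto simp: last_conv_nth)
      ultimately show "y \<in> (\<lambda>i. p ! i) ` B"
        using y by (auto simp: B_def)
    qed
    then have "card {y. adj (last p) y} \<le> card B"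
      by (intro surj_card_le) (simp_all add: B_def)
    then have "d \<le> card B"
      using deg[of "last p"] pC last_in_set[OF ne] by (meson order_trans subsetD)
    \<comment> \<open>Since \<open>length p < k <= 2 * d + 1\<close>, the path has fewer than
      \<open>2 * d\<close> links, so \<open>A\<close> and \<open>B\<close> must meet.\<close>
    have "card (A \<union> B) \<le> card {..<?l - 1}"
      by (intro card_mono) (auto simp: A_def B_def)
    moreover have "0 < ?l"
      using ne by simp
    ultimately have "card (A \<union> B) < 2 * d"
      using False k(1) unfolding card_lessThan by linarith
    moreover have "finite A" "finite B"
      by (simp_all add: A_def B_def)
    ultimately have "A \<inter> B \<noteq> {}"
      using card_Un_disjoint[of A B] \<open>d \<le> card A\<close> \<open>d \<le> card B\<close> by linarith
    then obtain i where i: "Suc i < ?l" "adj (hd p) (p ! Suc i)" "adj (last p) (p ! i)"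
      unfolding A_def B_def by (auto simp: less_diff_conv)
    define xs ys where "xs = take (Suc i) p" and "ys = drop (Suc i) p"
    have split: "p = xs @ ys" and ne': "xs \<noteq> []" "ys \<noteq> []"
      using i(1) by (auto simp: xs_def ys_def)
    have "hd xs = hd p" "last ys = last p"
      using ne' unfolding split by simp_all
    moreover have "hd ys = p ! Suc i" "last xs = p ! i"
      using i(1) by (simp_all add: xs_def ys_def hd_drop_conv_nth take_Suc_conv_app_nth)
    ultimately have ends: "adj (hd xs) (hd ys)" "adj (last xs) (last ys)"
      using i adj_sym by simp_all
    have "card (set p) < card C"
      using False k(2) dist by (simp add: distinct_card)
    then obtain z where z: "z \<in> C" "z \<notin> set p"
      using pC by (metis less_irrefl subsetI subset_antisym)
    have "adj\<^sup>*\<^sup>* (hd p) z"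
      using conn z(1) pC hd_in_set[OF ne] by blast
    \<comment> \<open>A walk that starts in \<open>set p\<close> and ends outside it has a step that
      leaves \<open>set p\<close>.\<close>
    then have "\<exists>u w. u \<in> set p \<and> w \<notin> set p \<and> adj u w"
      using z(2)
    proof (induction rule: rtranclp_induct)
      case base
      then show ?case
        using ne by simp
    next
      case (step y z)
      then show ?case
        by blast
    qed
    then obtain u w where uw: "u \<in> set p" "w \<notin> set p" "adj u w"
      by blast
    have "w \<in> C"
      using uw closed pC by blast
    moreover obtain q where "distinct q" "successively adj q" "set q = insert w (set p)"
        "length q = Suc ?l"
      using path_extension[of xs ys u w] dist ne' path ends uw adj_sym
      unfolding split successively_append_iff by blast
    ultimately have "P q"
      using pC by (auto simp: P_def)
    then show ?thesis
      using max[of q] \<open>length q = Suc ?l\<close> by simp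
  qed
qed

text \<open>Without such a path, every component has between \<open>Suc d\<close> and
  \<open>N\<close> vertices. Counting \<open>V\<close> by components, \<open>lower\<close> gives
  more than \<open>b\<close> of them and \<open>upper\<close> fewer than
  \<open>Suc b\<close>.\<close>

lemma path_of_min_degree:
  assumes deg: "\<And>x. x \<in> V \<Longrightarrow> d \<le> card {y. adj x y}"
    and k: "Suc N \<le> 2 * d + 1" and lower: "N * b < card V" and upper: "card V < Suc b * Suc d"
  shows "\<exists>p. distinct p \<and> length p = Suc N \<and> set p \<subseteq> V \<and> successively adj p"
proof (rule ccontr)
  assume no_path: "\<not> ?thesis"
  \<comment> \<open>The classes of \<open>R\<close> are the components. The restriction to
    \<open>V\<close> is needed for \<open>equiv V R\<close>, as the closure is reflexive outside
    \<open>V\<close> too.\<close>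
  define R where "R = {(x, y). x \<in> V \<and> y \<in> V \<and> adj\<^sup>*\<^sup>* x y}"
  have conn_sym: "adj\<^sup>*\<^sup>* y x" if "adj\<^sup>*\<^sup>* x y" for x y
    using that adj_sym by (metis sympD sympI symp_rtranclp)
  have eq: "equiv V R"
    by (rule equivI) (auto simp: R_def refl_on_def sym_def trans_def conn_sym intro: rtranclp_trans)
  have comp: "Suc d \<le> card C \<and> card C \<le> N" if C: "C \<in> V // R" for C
  proof
    obtain x where x: "x \<in> V" "C = R `` {x}"
      using C by (rule quotientE)
    have CV: "C \<subseteq> V" and "x \<in> C"
      using x by (auto simp: R_def)
    have closed: "z \<in> C" if "y \<in> C" "adj y z" for y z
      using that x(2) adj_in[OF that(2)] by (auto simp: R_def intro: rtranclp.rtrancl_into_rtrancl)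
    have finC: "finite C"
      using CV finite_V finite_subset by blast
    have "insert x {y. adj x y} \<subseteq> C"
      using closed \<open>x \<in> C\<close> by blast
    then have "card (insert x {y. adj x y}) \<le> card C"
      by (rule card_mono[OF finC])
    moreover have "finite {y. adj x y}"
      using adj_in finite_V by (auto intro: rev_finite_subset)
    ultimately show "Suc d \<le> card C"
      using deg[OF x(1)] adj_irrefl by simp
    show "card C \<le> N"
    proof (rule ccontr)
      assume "\<not> card C \<le> N"
      then have "\<exists>p. distinct p \<and> length p = Suc N \<and> set p \<subseteq> C \<and> successively adj p"
      proof (intro path_in_connected_set)
        show "adj\<^sup>*\<^sup>* y z" if "y \<in> C" "z \<in> C" for y z
          using that x(2) conn_sym by (auto simp: R_def intro: rtranclp_trans)
      qed (use CV closed deg k \<open>x \<in> C\<close> in auto)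
      then show False
        using no_path CV by blast
    qed
  qed
  have "card V = (\<Sum>C\<in>V // R. card C)"
    using card_Union_disjoint[of "V // R"] Union_quotient[OF eq] quotient_disj[OF eq]
      finite_V by (metis (no_types, lifting) Sup_upper disjnt_def finite_subset pairwise_def)
  moreover have "(\<Sum>C\<in>V // R. card C) \<le> card (V // R) * N"
    using sum_bounded_above[of "V // R" card N] comp by simp
  moreover have "card (V // R) * Suc d \<le> (\<Sum>C\<in>V // R. card C)"
    using sum_bounded_below[of "V // R" "Suc d" card] comp by simp
  ultimately have "card V \<le> card (V // R) * N" "card (V // R) * Suc d \<le> card V"
    by simp_all
  then have "b < card (V // R)" "card (V // R) < Suc b"
    using lower upper
    by (metis leI le_less_trans mult.commute mult_le_mono2 not_less)
      (meson leI le_less_trans mult_le_mono1 not_less upper \<open>card (V // R) * Suc d \<le> card V\<close>)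
  then show False
    by simp
qed

end

text \<open>With no star in the complement, a vertex has at most \<open>m - 1\<close> non-neighbours
  besides itself, hence at least \<open>d\<close> neighbours among \<open>d + m\<close>
  vertices.\<close>

lemma contains_path_or_costar:
  assumes G: "simple_graph G" and card: "card (verts G) = d + m" and "0 < m"
    and "N \<le> 2 * d" "N * b < d + m" "d + m < Suc b * Suc d"
  shows "contains_copy G (path_graph (Suc N)) \<or> contains_copy (complement G) (star_graph m)"
proof (rule disjCI)
  assume no_star: "\<not> contains_copy (complement G) (star_graph m)"
  have edge: "x \<in> verts G \<and> y \<in> verts G \<and> x \<noteq> y" if "{x, y} \<in> edges G" for x y
    using G that unfolding simple_graph_def by (meson doubleton_in_nsets_2 subsetD)
  have fin: "finite (verts G)"
    using G by (simp add: simple_graph_def)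
  interpret finite_adjacency "verts G" "\<lambda>x y. {x, y} \<in> edges G"
    using fin by unfold_locales (blast dest: edge, blast dest: edge, simp add: insert_commute, blast dest: edge)
  have "d \<le> card {y. {x, y} \<in> edges G}" if x: "x \<in> verts G" for x
  proof -
    let ?N = "{y. {x, y} \<in> edges G}" and ?M = "{y. {x, y} \<in> edges (complement G)}"
    have "card ?M < m"
      using no_star x contains_star_graph_iff[OF simple_graph_complement[OF G]]
      by (auto simp: complement_def not_le)
    moreover have "verts G = insert x (?N \<union> ?M)"
      using x edge by (auto simp: complement_def)
    then have "card (verts G) \<le> Suc (card (?N \<union> ?M))"
      by (metis card_insert_le_m1 diff_Suc_1 le_refl zero_less_Suc)
    then have "card (verts G) \<le> Suc (card ?N + card ?M)"
      using card_Un_le[of ?N ?M] by linarith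
    ultimately show ?thesis
      using card by linarith
  qed
  then show "contains_copy G (path_graph (Suc N))"
    unfolding contains_path_graph_iff using assms by (intro path_of_min_degree[of d N b]) auto
qed

section \<open>Disjoint unions of balanced cliques\<close>

text \<open>Within a residue class \<open>x\<close> is determined by \<open>x div k\<close>, which
  lies below \<open>N\<close>.\<close>

lemma card_residue_class_le:
  fixes s k N i :: nat
  assumes "s \<le> N * k"
  shows "card {x. x < s \<and> x mod k = i} \<le> N"
proof -
  have "inj_on (\<lambda>x. x div k) {x. x < s \<and> x mod k = i}"
    by (rule inj_onI) (metis (mono_tags, lifting) div_mult_mod_eq mem_Collect_eq)
  moreover have "(\<lambda>x. x div k) ` {x. x < s \<and> x mod k = i} \<subseteq> {..<N}"
    using assms by (auto simp: less_mult_imp_div_less)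
  ultimately show ?thesis
    using card_inj_on_le[of _ _ "{..<N}"] by fastforce
qed

lemma card_residue_class_ge:
  fixes s k q i :: nat
  assumes "q * k \<le> s" "i < k"
  shows "q \<le> card {x. x < s \<and> x mod k = i}"
proof -
  have "i + k * j < s" if "j < q" for j
  proof -
    have "i + k * j < k * Suc j"
      using assms(2) by simp
    also have "\<dots> \<le> k * q"
      using that by (intro mult_le_mono2) simp
    finally show ?thesis
      using assms(1) by (simp add: mult.commute)
  qed
  then have "(\<lambda>j. i + k * j) ` {..<q} \<subseteq> {x. x < s \<and> x mod k = i}"
    using assms(2) by auto
  then have "card ((\<lambda>j. i + k * j) ` {..<q}) \<le> card {x. x < s \<and> x mod k = i}"
    by (intro card_mono) auto
  moreover have "inj_on (\<lambda>j. i + k * j) {..<q}"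
    using assms(2) by (auto simp: inj_on_def)
  ultimately show ?thesis
    by (simp add: card_image)
qed

text \<open>For \<open>k > 0\<close> this is a disjoint union of \<open>k\<close> cliques on
  \<open>s\<close> vertices in all; taking residue classes as cliques makes their sizes differ by at
  most one.\<close>

definition residue_graph :: "nat \<Rightarrow> nat \<Rightarrow> nat graph" where
  "residue_graph s k = ({..<s}, {{x, y} | x y. x < s \<and> y < s \<and> x \<noteq> y \<and> x mod k = y mod k})"

lemma simple_graph_residue_graph: "simple_graph (residue_graph s k)"
  by (auto simp: simple_graph_def residue_graph_def)

lemma residue_graph_edge_iff:
  "{x, y} \<in> edges (residue_graph s k) \<longleftrightarrow> x < s \<and> y < s \<and> x \<noteq> y \<and> x mod k = y mod k"
  by (auto simp: residue_graph_def doubleton_eq_iff)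

lemma residue_graph_no_path:
  assumes "s \<le> N * k"
  shows "\<not> contains_copy (residue_graph s k) (path_graph (Suc N))"
proof
  assume "contains_copy (residue_graph s k) (path_graph (Suc N))"
  then obtain p where p: "distinct p" "length p = Suc N" "set p \<subseteq> {..<s}"
      "successively (\<lambda>x y. {x, y} \<in> edges (residue_graph s k)) p"
    by (auto simp: contains_path_graph_iff residue_graph_def)
  have step: "p ! i mod k = p ! Suc i mod k" if "Suc i < Suc N" for i
    using p(2,4) that by (simp add: successively_conv_nth residue_graph_edge_iff)
  have "p ! i mod k = p ! 0 mod k" if "i < Suc N" for i
    using that by (induction i) (use step in auto)
  then have "x mod k = p ! 0 mod k" if "x \<in> set p" for x
    using that p(2) unfolding in_set_conv_nth by metis
  then have "set p \<subseteq> {x. x < s \<and> x mod k = p ! 0 mod k}"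
    using p(3) by blast
  then have "card (set p) \<le> card {x. x < s \<and> x mod k = p ! 0 mod k}"
    by (intro card_mono) auto
  also have "\<dots> \<le> N"
    using assms by (rule card_residue_class_le)
  finally show False
    using p(1,2) by (simp add: distinct_card)
qed

text \<open>The neighbours of \<open>v\<close> in the complement are the vertices outside its
  clique, at most \<open>s - q < m\<close> of them.\<close>

lemma residue_graph_no_costar:
  assumes "0 < k" "q * k \<le> s" "s < q + m"
  shows "\<not> contains_copy (complement (residue_graph s k)) (star_graph m)"
proof -
  have "q * 1 \<le> q * k"
    using assms(1) by (intro mult_le_mono2) simp
  then have "0 < m"
    using assms(2,3) by linarith
  have "card {w. {v, w} \<in> edges (complement (residue_graph s k))} < m" if "v < s" for v
  proof -
    let ?C = "{x. x < s \<and> x mod k = v mod k}"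
    have "{w. {v, w} \<in> edges (complement (residue_graph s k))} \<subseteq> {..<s} - ?C"
      using residue_graph_edge_iff[of _ _ s k] by (auto simp: complement_def residue_graph_def)
    then have "card {w. {v, w} \<in> edges (complement (residue_graph s k))} \<le> card ({..<s} - ?C)"
      by (intro card_mono) auto
    also have "\<dots> = s - card ?C"
      by (subst card_Diff_subset) auto
    finally have "card {w. {v, w} \<in> edges (complement (residue_graph s k))} \<le> s - card ?C" .
    moreover have "q \<le> card ?C"
      using assms(1) by (intro card_residue_class_ge[OF assms(2)]) simp
    ultimately show ?thesis
      using assms(3) \<open>0 < m\<close> by linarith
  qed
  moreover have "verts (complement (residue_graph s k)) = {..<s}"
    by (simp add: complement_def residue_graph_def)
  ultimately show ?thesis
    unfolding contains_star_graph_iff[OF simple_graph_complement[OF simple_graph_residue_graph]]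
    by (metis lessThan_iff not_le)
qed

section \<open>The Ramsey number\<close>

definition induced_subgraph :: "'a graph \<Rightarrow> 'a set \<Rightarrow> 'a graph" where
  "induced_subgraph G W = (W, edges G \<inter> nsets W 2)"

lemma contains_copy_mono:
  assumes "contains_copy H F" "verts H \<subseteq> verts G" "edges H \<subseteq> edges G"
  shows "contains_copy G F"
  using assms unfolding contains_copy_def subgraph_def by (meson order_trans)

text \<open>The defining property speaks of exactly \<open>r\<close> vertices, so every
  \<open>r <= s\<close> must be refuted. One bad graph on \<open>s\<close> vertices suffices,
  because its induced subgraphs are bad as well.\<close>

lemma ramsey_number_eqI:
  fixes G :: "nat graph"
  assumes upper: "\<And>G :: nat graph. simple_graph G \<Longrightarrow> card (verts G) = Suc s \<Longrightarrow>
      contains_copy G G1 \<or> contains_copy (complement G) G2"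
    and G: "simple_graph G" "card (verts G) = s"
      "\<not> contains_copy G G1" "\<not> contains_copy (complement G) G2"
  shows "ramsey_number G1 G2 = Suc s"
  unfolding ramsey_number_def
proof (rule Least_equality)
  show "\<forall>G :: nat graph. simple_graph G \<and> card (verts G) = Suc s \<longrightarrow>
      contains_copy G G1 \<or> contains_copy (complement G) G2"
    using upper by blast
next
  fix r assume r: "\<forall>G :: nat graph. simple_graph G \<and> card (verts G) = r \<longrightarrow>
      contains_copy G G1 \<or> contains_copy (complement G) G2"
  show "Suc s \<le> r"
  proof (rule ccontr)
    assume "\<not> Suc s \<le> r"
    then obtain W where W: "W \<subseteq> verts G" "card W = r"
      using G(2) by (metis not_less_eq_eq obtain_subset_with_card_n)
    let ?H = "induced_subgraph G W"
    have "simple_graph ?H"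
      using G(1) W(1) by (auto simp: simple_graph_def induced_subgraph_def finite_subset)
    then have "contains_copy ?H G1 \<or> contains_copy (complement ?H) G2"
      using r W(2) by (simp add: induced_subgraph_def)
    \<comment> \<open>This is where the subgraph must be induced: a pair inside \<open>W\<close>
      missing from \<open>?H\<close> is also missing from \<open>G\<close>.\<close>
    moreover have "edges (complement ?H) \<subseteq> edges (complement G)"
      using nsets_mono[OF W(1)] by (auto simp: induced_subgraph_def complement_def)
    ultimately show False
      using G(3,4) W(1) contains_copy_mono[of ?H G1 G]
        contains_copy_mono[of "complement ?H" G2 "complement G"]
      by (auto simp: induced_subgraph_def complement_def)
  qed
qed

text \<open>Reduces both cases to arithmetic. The parameters \<open>k\<close> and \<open>q\<close>
  describe the lower bound: \<open>k\<close> cliques with at least \<open>q\<close> and at most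
  \<open>N\<close> vertices each. The parameters \<open>d\<close> and \<open>b\<close> belong to the
  component count on \<open>Suc s\<close> vertices.\<close>

lemma ramsey_number_path_star_eqI:
  assumes "0 < m" "0 < k" "s \<le> N * k" "q * k \<le> s" "s < q + m"
    and "Suc s = d + m" "N \<le> 2 * d" "N * b \<le> s" "Suc s < Suc b * Suc d"
  shows "ramsey_number (path_graph (Suc N)) (star_graph m) = Suc s"
proof (rule ramsey_number_eqI[where G = "residue_graph s k"])
  show "contains_copy G (path_graph (Suc N)) \<or> contains_copy (complement G) (star_graph m)"
    if "simple_graph G" "card (verts G) = Suc s" for G :: "nat graph"
    using that assms by (intro contains_path_or_costar[of G d m N b]) auto
qed (use assms simple_graph_residue_graph residue_graph_no_path residue_graph_no_costar
    in \<open>auto simp: residue_graph_def\<close>)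

text \<open>The extremal graph consists of \<open>b\<close> cliques with exactly \<open>N\<close>
  vertices; \<open>N * (b - 1) < M\<close> keeps stars out of its complement.\<close>

lemma ramsey_number_path_star_small:
  fixes N M b :: nat
  assumes "0 < N" "0 < M" "N * (b - 1) < M" "M \<le> N * b" and small: "M * Suc b \<le> N * b\<^sup>2"
  shows "ramsey_number (path_graph (Suc N)) (star_graph (Suc M)) = Suc (N * b)"
proof -
  have "0 < b"
    using assms by (cases b) auto
  define d where "d = N * b - M"
  have "N * b = d + M"
    using assms by (simp add: d_def)
  then have "N * b\<^sup>2 = (d + M) * b"
    by (simp add: power2_eq_square flip: mult.assoc)
  \<comment> \<open>Substituting \<open>N * b = d + M\<close> turns \<open>small\<close> into
    \<open>M <= d * b\<close>; adding \<open>d\<close> gives the claim.\<close>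
  then have d: "N * b \<le> d * Suc b"
    using small \<open>N * b = d + M\<close> by (simp add: algebra_simps)
  have "N * Suc b \<le> N * (2 * b)"
    using \<open>0 < b\<close> by (intro mult_le_mono2) simp
  also have "\<dots> \<le> 2 * d * Suc b"
    using d by simp
  finally have "N \<le> 2 * d"
    by (metis mult_le_cancel2 zero_less_Suc)
  have "Suc b * Suc d = d * Suc b + Suc b"
    by simp
  then have upper: "Suc (N * b) < Suc b * Suc d"
    using d \<open>0 < b\<close> by linarith
  have "N * b < N + Suc M"
    using assms(3) \<open>0 < b\<close> by (cases b) auto
  then show ?thesis
    using \<open>0 < b\<close> \<open>N \<le> 2 * d\<close> \<open>N * b = d + M\<close> upper
    by (intro ramsey_number_path_star_eqI[where k = b and q = N and d = d and b = b]) simp_all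
qed

text \<open>The extremal graph has \<open>Suc b\<close> cliques, each with at least
  \<open>M div b\<close> and at most \<open>N\<close> vertices. With one more vertex, the minimum
  degree to be exploited is \<open>M div b\<close>.\<close>

lemma ramsey_number_path_star_large:
  fixes N M b :: nat
  assumes "0 < N" "0 < M" "N * (b - 1) < M" "M \<le> N * b" and large: "N * b\<^sup>2 < M * Suc b"
  shows "ramsey_number (path_graph (Suc N)) (star_graph (Suc M)) = Suc (M div b + M)"
proof -
  define q where "q = M div b"
  have "0 < b"
    using assms by (cases b) auto
  have q: "q * b \<le> M" "M < Suc q * b"
    using \<open>0 < b\<close> by (simp_all add: q_def mult.commute dividend_less_times_div)
  have "q * b \<le> N * b"
    using q(1) assms(4) by linarith
  then have "q \<le> N"
    using \<open>0 < b\<close> by simp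
  \<comment> \<open>Otherwise \<open>2 * Suc q <= Suc N\<close>, hence
    \<open>2 * Suc M <= Suc N * b\<close>. Multiplied by \<open>Suc b\<close> and combined with
    \<open>large\<close>, this reads \<open>(N - 1) * b * (b - 1) + 2 < 0\<close>.\<close>
  have "N \<le> 2 * q"
  proof (rule ccontr)
    assume "\<not> N \<le> 2 * q"
    then have "Suc q * 2 * b \<le> Suc N * b"
      by (intro mult_le_mono1) simp
    then have "2 * Suc M \<le> Suc N * b"
      using q(2) by (simp add: algebra_simps)
    then have "2 * Suc M * Suc b \<le> Suc N * b * Suc b"
      by (rule mult_le_mono1)
    then have "2 * (M * Suc b) + 2 * Suc b \<le> N * b\<^sup>2 + b\<^sup>2 + N * b + b"
      by (simp add: algebra_simps power2_eq_square)
    then have "N * b\<^sup>2 + b + 2 < b\<^sup>2 + N * b"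
      using large by presburger
    moreover obtain K where "N = Suc K"
      using assms(1) gr0_implies_Suc by blast
    moreover have "K * b \<le> K * b\<^sup>2"
      using \<open>0 < b\<close> by (simp add: power2_eq_square)
    ultimately show False
      by simp
  qed
  \<comment> \<open>Otherwise multiplying \<open>Suc M + q <= N * b\<close> by \<open>b\<close> and
    using \<open>M < Suc q * b\<close> contradicts \<open>large\<close>.\<close>
  have "N * b \<le> M + q"
  proof (rule ccontr)
    assume "\<not> N * b \<le> M + q"
    then have "(Suc M + q) * b \<le> N * b * b"
      by (intro mult_le_mono1) simp
    then have "M * b + Suc q * b \<le> N * b\<^sup>2"
      by (simp add: algebra_simps power2_eq_square)
    then show False
      using q(2) large by simp
  qed
  show ?thesis
    unfolding q_def[symmetric]
    by (intro ramsey_number_path_star_eqI[where k = "Suc b" and q = q and d = q and b = b])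
      (use assms q \<open>q \<le> N\<close> \<open>N \<le> 2 * q\<close> \<open>N * b \<le> M + q\<close> in \<open>auto simp: algebra_simps\<close>)
qed

theorem theorem2:
  fixes n m :: nat
  assumes "n \<ge> 2" and "m \<ge> 2"
  shows "int (ramsey_number (path_graph n) (star_graph m)) = t n m"
proof -
  define N M where "N = n - 1" and "M = m - 1"
  have NM: "n = Suc N" "m = Suc M" "0 < N" "0 < M"
    using assms by (simp_all add: N_def M_def)
  have alpha: "alpha n m = real M / real N"
    by (simp add: alpha_def NM)
  define b where "b = nat (beta n m)"
  have beta: "beta n m = int b"
  proof -
    have "0 \<le> alpha n m"
      by (simp add: alpha)
    then have "0 \<le> beta n m"
      unfolding beta_def by linarith
    then show ?thesis
      by (simp add: b_def)
  qed
  then have ceil: "real b - 1 < real M / real N" "real M / real N \<le> real b"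
    unfolding beta_def alpha by linarith+
  then have real_bounds: "real N * (real b - 1) < real M" "real M \<le> real N * real b"
    using NM by (simp_all add: field_simps)
  have b: "0 < b"
    using real_bounds(2) NM by (cases b) auto
  \<comment> \<open>Positivity of \<open>b\<close> matters here: the truncated \<open>b - 1\<close>
    then agrees with the real difference.\<close>
  have "real (N * (b - 1)) < real M" "real M \<le> real (N * b)"
    using real_bounds b by (simp_all add: of_nat_diff)
  then have bounds: "N * (b - 1) < M" "M \<le> N * b"
    by (simp_all only: of_nat_less_iff of_nat_le_iff)
  have gamma: "alpha n m \<le> gamma n m \<longleftrightarrow> M * Suc b \<le> N * b\<^sup>2"
  proof -
    have "alpha n m \<le> gamma n m \<longleftrightarrow> real M * (real b + 1) \<le> real N * (real b)\<^sup>2"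
      using NM(3,4) b unfolding gamma_def beta alpha by (simp add: field_simps)
    also have "\<dots> \<longleftrightarrow> real (M * Suc b) \<le> real (N * b\<^sup>2)"
      by (simp add: algebra_simps)
    finally show ?thesis
      by (simp only: of_nat_le_iff)
  qed
  have t: "t n m = int (if M * Suc b \<le> N * b\<^sup>2 then Suc (N * b) else Suc (M div b + M))"
    unfolding t_def gamma beta using NM(1,2) by (simp add: floor_divide_of_nat_eq)
  show ?thesis
    unfolding t using ramsey_number_path_star_small[OF NM(3,4) bounds]
      ramsey_number_path_star_large[OF NM(3,4) bounds] NM(1,2) by auto
qed

end
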